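(* For integers $n \geq r \geq 6$, $rsat(n,C_r) \geq \frac{6}{5}n$.
   Context: All graphs are finite, simple and undirected. An edge-coloring of a graph $G$ is a function $\mathcal{C}:E(G)\to\mathbb{N}$; a (sub)graph is rainbow if all its edges have distinct colors. An edge-colored graph $G$ is $F$-rainbow saturated if it contains no rainbow copy of $F$ but adding any nonedge of $G$ with any color on it creates a rainbow copy of $F$. $rsat(n,F)$ is the minimum number of edges of a graph on $n$ vertices admitting an edge-coloring that makes it $F$-rainbow saturated. $C_r$ is the cycle on $r$ vertices. *)

theory Defs
  imports Complex_Main
begin

text \<open>A graph is a pair of a vertex set and a set of edges, each edge being the set of its two ends.\<close>

type_synonym 'a graph = "'a set \<times> 'a set set"

definition verts :: "'a graph \<Rightarrow> 'a set" where
  "verts G = fst G"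

definition edges :: "'a graph \<Rightarrow> 'a set set" where
  "edges G = snd G"

definition simple_graph :: "'a graph \<Rightarrow> bool" where
  "simple_graph G \<longleftrightarrow> finite (verts G) \<and> (\<forall>e \<in> edges G. e \<subseteq> verts G \<and> card e = 2)"

definition nonedges :: "'a graph \<Rightarrow> 'a set set" where
  "nonedges G = {e. e \<subseteq> verts G \<and> card e = 2 \<and> e \<notin> edges G}"

definition add_edge :: "'a graph \<Rightarrow> 'a set \<Rightarrow> 'a graph" where
  "add_edge G e = (verts G, insert e (edges G))"

definition subgraph :: "'a graph \<Rightarrow> 'a graph \<Rightarrow> bool" where
  "subgraph H G \<longleftrightarrow> simple_graph H \<and> verts H \<subseteq> verts G \<and> edges H \<subseteq> edges G"

definition isomorphic :: "'a graph \<Rightarrow> 'b graph \<Rightarrow> bool" where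
  "isomorphic F H \<longleftrightarrow>
     (\<exists>f. bij_betw f (verts F) (verts H) \<and> edges H = (\<lambda>e. f ` e) ` edges F)"

text \<open>
  The cycle on the vertices \<open>0, \<dots>, r - 1\<close>. It is the intended graph only for \<open>r \<ge> 3\<close>.
\<close>

definition cycle_graph :: "nat \<Rightarrow> nat graph" where
  "cycle_graph r = ({..<r}, {{i, (i + 1) mod r} | i. i < r})"

text \<open>
  An edge-coloring is a total function on vertex sets; only its values on edges matter, and it
  need not be proper.
\<close>

type_synonym 'a coloring = "'a set \<Rightarrow> nat"

definition rainbow :: "'a coloring \<Rightarrow> 'a graph \<Rightarrow> bool" where
  "rainbow C H \<longleftrightarrow> inj_on C (edges H)"

definition has_rainbow_copy :: "'b graph \<Rightarrow> 'a graph \<Rightarrow> 'a coloring \<Rightarrow> bool" where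
  "has_rainbow_copy F G C \<longleftrightarrow> (\<exists>H. subgraph H G \<and> isomorphic F H \<and> rainbow C H)"

definition rainbow_saturated :: "'b graph \<Rightarrow> 'a graph \<Rightarrow> 'a coloring \<Rightarrow> bool" where
  "rainbow_saturated F G C \<longleftrightarrow>
     \<not> has_rainbow_copy F G C \<and>
     (\<forall>e \<in> nonedges G. \<forall>c. has_rainbow_copy F (add_edge G e) (C(e := c)))"

text \<open>
  Every graph on \<open>n\<close> vertices is isomorphic to one whose vertices are natural numbers, so it
  suffices to range over those.
\<close>

definition rsat :: "nat \<Rightarrow> 'b graph \<Rightarrow> nat" where
  "rsat n F =
     (LEAST m. \<exists>(G :: nat graph) C. simple_graph G \<and> card (verts G) = n \<and>
        rainbow_saturated F G C \<and> card (edges G) = m)"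

lemma simple_graph_cycle_graph:
  assumes "r \<ge> 3"
  shows "simple_graph (cycle_graph r)"
proof -
  have "i \<noteq> (i + 1) mod r" if "i < r" for i
    using that assms by (cases "i + 1 = r") auto
  then show ?thesis
    using assms by (auto simp: simple_graph_def cycle_graph_def verts_def edges_def card_2_iff)
qed

text \<open>
  The minimum in \<open>rsat\<close> is attained as soon as \<open>F\<close> has two edges: a complete graph with
  all edges of one color has no nonedge and no rainbow copy of \<open>F\<close>.
\<close>

lemma rsat_attained:
  fixes F :: "'b graph"
  assumes F: "simple_graph F" "e1 \<in> edges F" "e2 \<in> edges F" "e1 \<noteq> e2"
  shows "\<exists>(G :: nat graph) C. simple_graph G \<and> card (verts G) = n \<and>
           rainbow_saturated F G C \<and> card (edges G) = rsat n F"
proof -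
  define K :: "nat graph" where "K = ({..<n}, {e. e \<subseteq> {..<n} \<and> card e = 2})"
  have K: "simple_graph K" "card (verts K) = n" "nonedges K = {}"
    by (auto simp: K_def simple_graph_def nonedges_def verts_def edges_def)
  have "\<not> has_rainbow_copy F K (\<lambda>_. 0)"
  proof
    assume "has_rainbow_copy F K (\<lambda>_. 0)"
    then obtain H :: "nat graph" and f where H: "bij_betw f (verts F) (verts H)"
        "edges H = (\<lambda>e. f ` e) ` edges F" "inj_on (\<lambda>_. 0 :: nat) (edges H)"
      by (auto simp: has_rainbow_copy_def isomorphic_def rainbow_def)
    have "f ` e1 \<in> edges H" "f ` e2 \<in> edges H"
      using H(2) F(2,3) by simp_all
    then have "f ` e1 = f ` e2"
      using H(3) by (simp add: inj_on_def)
    moreover have "e1 \<subseteq> verts F" "e2 \<subseteq> verts F"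
      using F by (auto simp: simple_graph_def)
    ultimately show False
      using H(1) F(4) by (metis bij_betw_def inj_on_image_eq_iff)
  qed
  then have "rainbow_saturated F K (\<lambda>_. 0)"
    using K by (simp add: rainbow_saturated_def)
  then have "\<exists>m. \<exists>(G :: nat graph) C. simple_graph G \<and> card (verts G) = n \<and>
      rainbow_saturated F G C \<and> card (edges G) = m"
    using K by blast
  then show ?thesis
    unfolding rsat_def by (rule LeastI_ex)
qed

end

theory Submission
  imports Defs
begin

text \<open>
  In a \<open>C\<^sub>r\<close>-rainbow saturated graph the ends of a nonedge are joined, for every color \<open>c\<close>, by a
  path on \<open>r\<close> vertices without edges of color \<open>c\<close>. So no monochromatic edge cut separates the
  ends of a nonedge; in particular all degrees are at least 2. Let \<open>u\<close> and \<open>v\<close> be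
  adjacent vertices of degree 2 with further neighbors \<open>x\<close> and \<open>y\<close>. Forbidding the color of
  \<open>ux\<close>, a path from \<open>u\<close> to \<open>y\<close> has to be \<open>uvy\<close>, which is too short; hence \<open>x = y\<close>, and \<open>x\<close>
  has degree at least 4, as the triangle \<open>uvx\<close> would otherwise be cut off by at most one edge.

  Now give each vertex \<open>v\<close> the charge \<open>5 deg v - 12\<close>. A vertex of degree 2 receives 1 from each of
  its neighbors, or 2 from the apex of its triangle if it has a neighbor of degree 2. Then no
  charge is negative, so \<open>10 |E| \<ge> 12 n\<close>.
\<close>

section \<open>Neighborhoods and double counting\<close>

definition nbhd :: "'a graph \<Rightarrow> 'a \<Rightarrow> 'a set" where
  "nbhd G v = {x. {v, x} \<in> edges G}"

lemma verts_cycle_graph: "verts (cycle_graph r) = {..<r}"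
  by (simp add: cycle_graph_def verts_def)

lemma edges_cycle_graph: "edges (cycle_graph r) = (\<lambda>i. {i, Suc i mod r}) ` {..<r}"
  by (simp add: cycle_graph_def edges_def lessThan_def image_Collect)

lemma nbhd_sym: "x \<in> nbhd G v \<longleftrightarrow> v \<in> nbhd G x"
  by (simp add: nbhd_def insert_commute)

lemma nbhd_subset_verts: "simple_graph G \<Longrightarrow> nbhd G v \<subseteq> verts G"
  by (auto simp: nbhd_def simple_graph_def)

lemma finite_nbhd: "simple_graph G \<Longrightarrow> finite (nbhd G v)"
  by (metis finite_subset nbhd_subset_verts simple_graph_def)

lemma not_in_own_nbhd: "simple_graph G \<Longrightarrow> v \<notin> nbhd G v"
  by (auto simp: nbhd_def simple_graph_def)

text \<open>Handshake lemma: incident pairs of a vertex and an edge are counted both ways.\<close>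

lemma sum_card_nbhd:
  assumes G: "simple_graph G"
  shows "(\<Sum>v\<in>verts G. card (nbhd G v)) = 2 * card (edges G)"
proof -
  have fin: "finite (verts G)" "finite (edges G)"
    using G by (auto simp: simple_graph_def intro: finite_subset[of "edges G" "Pow (verts G)"])
  have "card (nbhd G v) = card {e. e \<in> edges G \<and> v \<in> e}" for v
  proof -
    have "bij_betw (\<lambda>x. {v, x}) (nbhd G v) {e. e \<in> edges G \<and> v \<in> e}"
      unfolding bij_betw_def
    proof
      show "inj_on (\<lambda>x. {v, x}) (nbhd G v)"
        by (auto simp: inj_on_def doubleton_eq_iff)
      have "e \<in> (\<lambda>x. {v, x}) ` nbhd G v" if e: "e \<in> edges G" "v \<in> e" for e
      proof -
        have "card e = 2"
          using G e by (simp add: simple_graph_def)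
        then obtain x where "e = {v, x}"
          using e(2) by (auto simp: card_2_iff)
        then show ?thesis
          using e(1) by (simp add: nbhd_def)
      qed
      then show "(\<lambda>x. {v, x}) ` nbhd G v = {e. e \<in> edges G \<and> v \<in> e}"
        by (auto simp: nbhd_def)
    qed
    then show ?thesis
      by (rule bij_betw_same_card)
  qed
  then have "(\<Sum>v\<in>verts G. card (nbhd G v)) = (\<Sum>v\<in>verts G. \<Sum>e | e \<in> edges G \<and> v \<in> e. 1)"
    by simp
  also have "\<dots> = (\<Sum>e\<in>edges G. \<Sum>v | v \<in> verts G \<and> v \<in> e. 1)"
    using fin by (rule sum.swap_restrict)
  also have "\<dots> = (\<Sum>e\<in>edges G. 2 :: nat)"
  proof (rule sum.cong)
    fix e assume "e \<in> edges G"
    then have "card e = 2" "{v. v \<in> verts G \<and> v \<in> e} = e"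
      using G by (auto simp: simple_graph_def)
    then show "(\<Sum>v | v \<in> verts G \<and> v \<in> e. 1) = (2 :: nat)"
      by simp
  qed simp
  finally show ?thesis
    by simp
qed

text \<open>Conservation of charge: if \<open>w v x\<close> is what \<open>v\<close> receives from
  \<open>x\<close>, the totals received and sent agree.\<close>

lemma sum_nbhd_swap:
  fixes w :: "'a \<Rightarrow> 'a \<Rightarrow> int"
  assumes G: "simple_graph G"
  shows "(\<Sum>v\<in>verts G. \<Sum>x\<in>nbhd G v. w v x) = (\<Sum>v\<in>verts G. \<Sum>x\<in>nbhd G v. w x v)"
proof -
  have fin: "finite (verts G)"
    using G by (simp add: simple_graph_def)
  have N: "nbhd G v = {x. x \<in> verts G \<and> {v, x} \<in> edges G}"
    "nbhd G v = {x. x \<in> verts G \<and> {x, v} \<in> edges G}" for v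
    using nbhd_subset_verts[OF G, of v] by (auto simp: nbhd_def insert_commute)
  have "(\<Sum>v\<in>verts G. \<Sum>x\<in>nbhd G v. w v x)
      = (\<Sum>v\<in>verts G. \<Sum>x | x \<in> verts G \<and> {v, x} \<in> edges G. w v x)"
    by (simp only: N(1))
  also have "\<dots> = (\<Sum>x\<in>verts G. \<Sum>v | v \<in> verts G \<and> {v, x} \<in> edges G. w v x)"
    using fin fin by (rule sum.swap_restrict)
  also have "\<dots> = (\<Sum>v\<in>verts G. \<Sum>x\<in>nbhd G v. w x v)"
    by (simp only: N(2))
  finally show ?thesis .
qed

section \<open>Paths and cuts forced by saturation\<close>

text \<open>Adding the nonedge with color \<open>c\<close> closes a rainbow cycle through it.
  Deleting the new edge leaves the path, and no other edge of the cycle can repeat the color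
  \<open>c\<close>.\<close>

lemma rainbow_saturated_path:
  assumes sat: "rainbow_saturated (cycle_graph r) G C" and r: "r \<ge> 3"
    and uv: "{u, v} \<in> nonedges G"
  shows "\<exists>p. p 0 = u \<and> p (r - 1) = v \<and> inj_on p {..<r} \<and>
           (\<forall>i. Suc i < r \<longrightarrow> {p i, p (Suc i)} \<in> edges G \<and> C {p i, p (Suc i)} \<noteq> c)"
    (is "\<exists>p. ?path u v p")
proof -
  let ?e = "{u, v}" and ?C = "C({u, v} := c)"
  obtain H f where H: "subgraph H (add_edge G ?e)" "inj_on ?C (edges H)"
      and f: "bij_betw f {..<r} (verts H)" "edges H = (\<lambda>e. f ` e) ` edges (cycle_graph r)"
  proof -
    have "has_rainbow_copy (cycle_graph r) (add_edge G ?e) ?C"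
      using sat uv unfolding rainbow_saturated_def by blast
    then show ?thesis
      using that unfolding has_rainbow_copy_def isomorphic_def rainbow_def
      by (auto simp: verts_cycle_graph)
  qed
  have H_sub: "edges H \<subseteq> insert ?e (edges G)"
    using H(1) by (simp add: subgraph_def add_edge_def edges_def)
  \<comment> \<open>Otherwise the copy lies in \<open>G\<close> and is rainbow under
    \<open>C\<close> already, as only \<open>?e\<close> was recolored.\<close>
  have "?e \<in> edges H"
  proof (rule ccontr)
    assume "?e \<notin> edges H"
    then have "edges H \<subseteq> edges G" "inj_on C (edges H) = inj_on ?C (edges H)"
      using H_sub by (auto intro!: inj_on_cong)
    then have "subgraph H G" "inj_on C (edges H)"
      using H by (simp_all add: subgraph_def add_edge_def verts_def)
    then have "has_rainbow_copy (cycle_graph r) G C"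
      using f unfolding has_rainbow_copy_def isomorphic_def rainbow_def verts_cycle_graph
      by blast
    then show False
      using sat by (simp add: rainbow_saturated_def)
  qed
  have edges_H: "edges H = (\<lambda>i. {f i, f (Suc i mod r)}) ` {..<r}"
    unfolding f(2) edges_cycle_graph by (simp add: image_image)
  then obtain k where k: "k < r" "?e = {f k, f (Suc k mod r)}"
    using \<open>?e \<in> edges H\<close> by auto
  \<comment> \<open>Rotates the cycle so that the new edge is the closing one, from
    \<open>p (r - 1)\<close> to \<open>p 0\<close>.\<close>
  define p where "p = (\<lambda>i. f ((Suc k + i) mod r))"
  have inj_f: "inj_on f {..<r}"
    using f(1) by (simp add: bij_betw_def)
  have inj_p: "inj_on p {..<r}"
  proof
    fix i j assume ij: "i \<in> {..<r}" "j \<in> {..<r}" "p i = p j"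
    then have "(Suc k + i) mod r = (Suc k + j) mod r"
      using inj_onD[OF inj_f] r by (simp add: p_def)
    then have "i mod r = j mod r"
      unfolding nat_mod_eq_iff by (simp add: add.assoc)
    then show "i = j"
      using ij by simp
  qed
  have p0: "p 0 = f (Suc k mod r)"
    by (simp add: p_def)
  have p1: "p (r - 1) = f k"
    using k(1) by (simp add: p_def)
  have e_p: "?e = {p (r - 1), p 0}"
    using k(2) p0 p1 by simp
  have step: "{p i, p (Suc i)} \<in> edges G \<and> C {p i, p (Suc i)} \<noteq> c" if i: "Suc i < r" for i
  proof -
    let ?d = "{p i, p (Suc i)}"
    have dH: "?d \<in> edges H"
      unfolding edges_H using r
      by (intro image_eqI[of _ _ "(Suc k + i) mod r"]) (auto simp: p_def mod_Suc_eq)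
    have "p (r - 1) \<noteq> p i"
      using inj_onD[OF inj_p, of "r - 1" i] i by auto
    \<comment> \<open>Equality would force \<open>i = 0\<close> and \<open>Suc i = r - 1\<close>,
      that is \<open>r = 2\<close>.\<close>
    moreover have "\<not> (p (r - 1) = p (Suc i) \<and> p 0 = p i)"
      using inj_onD[OF inj_p, of "r - 1" "Suc i"] inj_onD[OF inj_p, of 0 i] i r by auto
    ultimately have "?d \<noteq> ?e"
      unfolding e_p by (auto simp: doubleton_eq_iff)
    moreover have "?d \<in> edges G"
      using dH H_sub \<open>?d \<noteq> ?e\<close> by auto
    moreover have "?C ?d \<noteq> ?C ?e"
      using inj_onD[OF H(2) _ dH \<open>?e \<in> edges H\<close>] \<open>?d \<noteq> ?e\<close> by blast
    ultimately show ?thesis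
      by simp
  qed
  consider "u = p 0" "v = p (r - 1)" | "v = p 0" "u = p (r - 1)"
    using e_p by (auto simp: doubleton_eq_iff)
  then show ?thesis
  proof cases
    case 1
    then show ?thesis
      using inj_p step by blast
  next
    case 2
    \<comment> \<open>Here the path runs from \<open>v\<close> to \<open>u\<close>, so it is
      reversed.\<close>
    let ?q = "\<lambda>i. p (r - 1 - i)"
    have "inj_on ?q {..<r}"
    proof
      fix i j assume "i \<in> {..<r}" "j \<in> {..<r}" "?q i = ?q j"
      then show "i = j"
        using inj_onD[OF inj_p, of "r - 1 - i" "r - 1 - j"] by auto
    qed
    moreover have "{?q i, ?q (Suc i)} \<in> edges G \<and> C {?q i, ?q (Suc i)} \<noteq> c" if "Suc i < r" for i
    proof -
      have "Suc (r - 1 - Suc i) = r - 1 - i"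
        using that by simp
      then show ?thesis
        using step[of "r - 1 - Suc i"] that by (simp add: insert_commute)
    qed
    ultimately have "?path u v ?q"
      using 2 by simp
    then show ?thesis
      by (rule exI[of _ ?q])
  qed
qed

lemma nonedgeI:
  "u \<in> verts G \<Longrightarrow> v \<in> verts G \<Longrightarrow> u \<noteq> v \<Longrightarrow> v \<notin> nbhd G u \<Longrightarrow> {u, v} \<in> nonedges G"
  by (simp add: nonedges_def nbhd_def)

text \<open>The path avoiding \<open>c\<close> has to leave \<open>S\<close> along some
  edge.\<close>

lemma rainbow_saturated_cut:
  assumes sat: "rainbow_saturated (cycle_graph r) G C" and r: "r \<ge> 3"
    and uv: "{u, v} \<in> nonedges G" and S: "u \<in> S" "v \<notin> S"
  obtains x y where "x \<in> S" "y \<notin> S" "y \<in> nbhd G x" "C {x, y} \<noteq> c"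
proof -
  obtain p where p: "p 0 = u" "p (r - 1) = v"
      "\<And>i. Suc i < r \<Longrightarrow> {p i, p (Suc i)} \<in> edges G \<and> C {p i, p (Suc i)} \<noteq> c"
    using rainbow_saturated_path[OF sat r uv, of c] by blast
  have "\<exists>i. Suc i < r \<and> p i \<in> S \<and> p (Suc i) \<notin> S"
  proof (rule ccontr)
    assume "\<nexists>i. Suc i < r \<and> p i \<in> S \<and> p (Suc i) \<notin> S"
    then have "i < r \<Longrightarrow> p i \<in> S" for i
      using S p(1) by (induction i) auto
    then show False
      using S p(2) r by auto
  qed
  then show thesis
    using that p(3) by (auto simp: nbhd_def)
qed

section \<open>Vertices of small degree\<close>

text \<open>Unless \<open>u\<close> is adjacent to all other vertices, the cut around
  \<open>{u}\<close> is not monochromatic: one use of it yields an edge at \<open>u\<close>, and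
  forbidding that edge's color yields another.\<close>

lemma rainbow_saturated_min_degree:
  assumes G: "simple_graph G" and sat: "rainbow_saturated (cycle_graph r) G C"
    and r: "r \<ge> 3" and n: "card (verts G) \<ge> 3" and u: "u \<in> verts G"
  shows "card (nbhd G u) \<ge> 2"
proof (cases "verts G - {u} \<subseteq> nbhd G u")
  case True
  then have "card (verts G - {u}) \<le> card (nbhd G u)"
    by (intro card_mono finite_nbhd G)
  then show ?thesis
    using n u G by (simp add: simple_graph_def)
next
  case False
  then obtain w where "w \<in> verts G" "w \<noteq> u" "w \<notin> nbhd G u"
    by auto
  then have uw: "{u, w} \<in> nonedges G" "w \<notin> {u}"
    using nonedgeI[OF u, of w] by auto
  obtain x where x: "x \<in> nbhd G u"
    using rainbow_saturated_cut[OF sat r uw(1) _ uw(2)] by blast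
  obtain y where y: "y \<in> nbhd G u" "C {u, y} \<noteq> C {u, x}"
    using rainbow_saturated_cut[OF sat r uw(1) _ uw(2), of "C {u, x}"] by blast
  have "card {x, y} \<le> card (nbhd G u)"
    using x y by (intro card_mono finite_nbhd G) auto
  then show ?thesis
    using y by (cases "x = y") auto
qed

lemma card_2_other:
  assumes "card A = 2" "a \<in> A"
  obtains b where "A = {a, b}" "b \<noteq> a"
  using assms by (auto simp: card_2_iff)

lemma rainbow_saturated_adjacent_degree_2:
  assumes G: "simple_graph G" and sat: "rainbow_saturated (cycle_graph r) G C"
    and r: "r \<ge> 4" and n: "card (verts G) \<ge> 4" and u: "u \<in> verts G"
    and deg: "card (nbhd G u) = 2" "card (nbhd G v) = 2" and uv: "v \<in> nbhd G u"
  obtains x where "nbhd G u = {v, x}" "x \<noteq> v" "card (nbhd G x) \<ge> 4"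
proof -
  obtain x where x: "nbhd G u = {v, x}" "x \<noteq> v"
    using deg(1) uv by (rule card_2_other)
  obtain y where y: "nbhd G v = {u, y}" "y \<noteq> u"
    using deg(2) nbhd_sym[of v G u] uv by (auto elim: card_2_other)
  have neq: "u \<noteq> v" "u \<noteq> x" "v \<noteq> y"
    using x y not_in_own_nbhd[OF G] by auto
  have verts: "v \<in> verts G" "x \<in> verts G" "y \<in> verts G"
    using x y nbhd_subset_verts[OF G] by blast+
  have "x = y"
  proof (rule ccontr)
    assume "x \<noteq> y"
    then have "{u, y} \<in> nonedges G"
      using u verts x y neq by (intro nonedgeI) auto
    then obtain p where p: "p 0 = u" "p (r - 1) = y" "inj_on p {..<r}"
        "\<And>i. Suc i < r \<Longrightarrow> p (Suc i) \<in> nbhd G (p i) \<and> C {p i, p (Suc i)} \<noteq> C {u, x}"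
      using rainbow_saturated_path[OF sat, of u y "C {u, x}"] r unfolding nbhd_def by auto
    have "p 1 = v"
      using p(4)[of 0] p(1) x r by auto
    moreover have "p 2 \<noteq> p 0"
      using inj_onD[OF p(3), of 2 0] r by auto
    \<comment> \<open>The path is forced to start with \<open>u\<close>, \<open>v\<close>,
      \<open>y\<close>, but injectivity allows \<open>y\<close> only at index \<open>r - 1\<close>,
      which is at least 3.\<close>
    ultimately have "p 2 = p (r - 1)"
      using p(4)[of 1] p(1,2) y r by (auto simp: numeral_2_eq_2)
    then show False
      using inj_onD[OF p(3), of 2 "r - 1"] r by auto
  qed
  let ?S = "{u, v, x}"
  have "\<not> card (nbhd G x) < 4"
  proof
    assume less: "card (nbhd G x) < 4"
    have sub: "{u, v} \<subseteq> nbhd G x"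
      using nbhd_sym[of x G u] nbhd_sym[of x G v] x y \<open>x = y\<close> by auto
    have "card (nbhd G x - {u, v}) = card (nbhd G x) - card {u, v}"
      using sub by (intro card_Diff_subset) auto
    then have "card (nbhd G x - {u, v}) \<le> Suc 0"
      using less neq by simp
    \<comment> \<open>Any edge leaving the triangle is \<open>{x, z}\<close>, so forbidding its
      color closes the cut. If no edge leaves, \<open>z\<close> is arbitrary.\<close>
    then obtain z where z: "nbhd G x - {u, v} \<subseteq> {z}"
      using finite_nbhd[OF G, of x] by (metis card_le_Suc0_iff_eq finite_Diff insertCI subsetI)
    have "\<not> verts G \<subseteq> ?S"
    proof
      assume "verts G \<subseteq> ?S"
      then have "card (verts G) \<le> card ?S"
        by (intro card_mono) auto
      also have "\<dots> \<le> 3"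
        by (intro card_insert_le_m1) (auto simp: card_insert_if)
      finally show False
        using n by simp
    qed
    then obtain w where w: "w \<in> verts G" "w \<notin> ?S"
      by auto
    have "{u, w} \<in> nonedges G"
      using u w x by (intro nonedgeI) auto
    then obtain a b where "a \<in> ?S" "b \<notin> ?S" "b \<in> nbhd G a" "C {a, b} \<noteq> C {x, z}"
      using rainbow_saturated_cut[OF sat, of u w ?S "C {x, z}"] w r by auto
    then show False
      using x y z \<open>x = y\<close> by auto
  qed
  then show thesis
    using that x by simp
qed

section \<open>Discharging and the final bound\<close>

lemma rainbow_saturated_edges_ge:
  assumes G: "simple_graph G" and sat: "rainbow_saturated (cycle_graph r) G C"
    and r: "r \<ge> 4" and n: "card (verts G) \<ge> 4"
  shows "6 * card (verts G) \<le> 5 * card (edges G)"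
proof -
  define D where "D = {v \<in> verts G. card (nbhd G v) = 2}"
  \<comment> \<open>\<open>w v x\<close> is the charge that \<open>v\<close> receives from
    \<open>x\<close>. The value 2 occurs when the other neighbor of \<open>v\<close> has degree 2,
    so that \<open>x\<close> is the apex of their triangle.\<close>
  define w :: "'a \<Rightarrow> 'a \<Rightarrow> int" where
    "w v x = (if v \<in> D \<and> x \<notin> D then if nbhd G v \<inter> D = {} then 1 else 2 else 0)" for v x
  have apex: "\<exists>x. nbhd G v = {z, x} \<and> x \<noteq> z \<and> card (nbhd G x) \<ge> 4"
    if "v \<in> D" "z \<in> D" "z \<in> nbhd G v" for v z
    using rainbow_saturated_adjacent_degree_2[OF G sat r n, of v z] that unfolding D_def by blast
  \<comment> \<open>Nonnegativity of the final charge, with the negative terms moved to the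
    left.\<close>
  have charge: "12 + (\<Sum>x\<in>nbhd G v. w x v) \<le> 5 * int (card (nbhd G v)) + (\<Sum>x\<in>nbhd G v. w v x)"
    if v: "v \<in> verts G" for v
  proof (cases "v \<in> D")
    case True
    \<comment> \<open>The initial charge at degree 2 is -2, so this is exactly what is
      missing.\<close>
    have "(\<Sum>x\<in>nbhd G v. w v x) = 2"
    proof (cases "nbhd G v \<inter> D = {}")
      case none: True
      then have "(\<Sum>x\<in>nbhd G v. w v x) = (\<Sum>x\<in>nbhd G v. 1)"
        using True by (intro sum.cong) (auto simp: w_def)
      then show ?thesis
        using True by (simp add: D_def)
    next
      case False
      then obtain z where z: "z \<in> nbhd G v" "z \<in> D"
        by auto
      obtain x where x: "nbhd G v = {z, x}" "x \<noteq> z" "card (nbhd G x) \<ge> 4"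
        using apex[OF True z(2,1)] by blast
      then have "x \<notin> D"
        by (simp add: D_def)
      then show ?thesis
        using x z True by (simp add: w_def)
    qed
    moreover have "(\<Sum>x\<in>nbhd G v. w x v) = 0"
      using True by (simp add: w_def)
    ultimately show ?thesis
      using True by (simp add: D_def)
  next
    case False
    then have out: "(\<Sum>x\<in>nbhd G v. w v x) = 0"
      by (simp add: w_def)
    have "card (nbhd G v) \<ge> 3"
      using False v rainbow_saturated_min_degree[OF G sat _ _ v] r n by (fastforce simp: D_def)
    then consider "card (nbhd G v) = 3" | "card (nbhd G v) \<ge> 4"
      by linarith
    then show ?thesis
    proof cases
      case 1
      \<comment> \<open>The charge 3 at degree 3 pays 1 to each neighbor. A payment of 2 would make
        \<open>v\<close> an apex, of degree at least 4.\<close>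
      have "w x v \<le> 1" if "x \<in> nbhd G v" for x
      proof -
        have False if z: "x \<in> D" "z \<in> nbhd G x" "z \<in> D" for z
        proof -
          have "v \<in> nbhd G x"
            using \<open>x \<in> nbhd G v\<close> by (simp add: nbhd_sym)
          moreover obtain y where "nbhd G x = {z, y}" "card (nbhd G y) \<ge> 4"
            using apex[OF z(1,3,2)] by blast
          ultimately show False
            using 1 z False by auto
        qed
        then show ?thesis
          by (auto simp: w_def)
      qed
      then have "(\<Sum>x\<in>nbhd G v. w x v) \<le> int (card (nbhd G v)) * 1"
        by (intro sum_bounded_above) auto
      then show ?thesis
        using 1 out by simp
    next
      case 2
      \<comment> \<open>Affordable because \<open>5 d - 12 >= 2 d\<close> for
        \<open>d >= 4\<close>.\<close>
      have "(\<Sum>x\<in>nbhd G v. w x v) \<le> int (card (nbhd G v)) * 2"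
        by (intro sum_bounded_above) (auto simp: w_def)
      then show ?thesis
        using 2 out by simp
    qed
  qed
  have "(\<Sum>v\<in>verts G. 12 + (\<Sum>x\<in>nbhd G v. w x v))
      \<le> (\<Sum>v\<in>verts G. 5 * int (card (nbhd G v)) + (\<Sum>x\<in>nbhd G v. w v x))"
    by (intro sum_mono charge)
  \<comment> \<open>The transfers cancel in the sum over all vertices.\<close>
  then have "12 * int (card (verts G)) \<le> 5 * int (\<Sum>v\<in>verts G. card (nbhd G v))"
    using sum_nbhd_swap[OF G, of w] by (simp add: sum.distrib sum_distrib_left)
  then show ?thesis
    using sum_card_nbhd[OF G] by simp
qed

theorem theorem1p7:
  fixes n r :: nat
  assumes "r \<ge> 6" and "n \<ge> r"
  shows "real (rsat n (cycle_graph r)) \<ge> 6 / 5 * real n"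
proof -
  \<comment> \<open>Two distinct edges of the cycle ensure that the minimum in \<open>rsat\<close>
    is attained by some \<open>G\<close>.\<close>
  have e: "{0, 1} \<in> edges (cycle_graph r)" "{1, 2} \<in> edges (cycle_graph r)"
    using imageI[of 0 "{..<r}" "\<lambda>i. {i, Suc i mod r}"]
      imageI[of 1 "{..<r}" "\<lambda>i. {i, Suc i mod r}"] assms
    unfolding edges_cycle_graph by (simp_all add: numeral_2_eq_2)
  have neq: "{0, 1} \<noteq> {1, 2 :: nat}"
    by (simp add: doubleton_eq_iff)
  have "simple_graph (cycle_graph r)"
    using assms by (intro simple_graph_cycle_graph) simp
  from rsat_attained[OF this e neq, where n = n]
  obtain G :: "nat graph" and C where G: "simple_graph G" "card (verts G) = n"
      "rainbow_saturated (cycle_graph r) G C" "card (edges G) = rsat n (cycle_graph r)"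
    by (elim exE conjE)
  have "6 * n \<le> 5 * rsat n (cycle_graph r)"
    using rainbow_saturated_edges_ge[OF G(1,3)] G(2,4) assms by simp
  then have "6 * real n \<le> 5 * real (rsat n (cycle_graph r))"
    by (metis of_nat_le_iff of_nat_mult of_nat_numeral)
  then show ?thesis
    by simp
qed

end
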